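(* Let $\lambda$ be an infinite cardinal, let $\sigma$ be the least group congruence on the monoid $\mathscr{I}^{\mathrm{cf}}_\lambda$ of injective partial cofinite selfmaps of $\lambda$, and let $\pi_\sigma\colon\mathscr{I}^{\mathrm{cf}}_\lambda\to\mathscr{I}^{\mathrm{cf}}_\lambda/\sigma$ be the natural homomorphism. Then the following conditions hold: (i) $(H(\mathbb{I}))\pi_\sigma=\mathscr{S}_\lambda/\mathscr{S}^\infty_\lambda$ is a normal subgroup of the group $\mathscr{I}^{\mathrm{cf}}_\lambda/\sigma$; (ii) the group $\mathscr{I}^{\mathrm{cf}}_\lambda/\sigma$ contains an infinite cyclic subgroup $G$ (i.e., a subgroup isomorphic to the additive group of integers $\mathbb{Z}(+)$) such that $G\cap\mathscr{S}_\lambda/\mathscr{S}^\infty_\lambda=\{e\}$, where $e$ is the unit of the group $\mathscr{I}^{\mathrm{cf}}_\lambda/\sigma$; (iii) for this $G$, $(\mathscr{S}_\lambda/\mathscr{S}^\infty_\lambda)\cdot G=\mathscr{I}^{\mathrm{cf}}_\lambda/\sigma$; and hence the group $\mathscr{I}^{\mathrm{cf}}_\lambda/\sigma$ is isomorphic to a semidirect product $\mathscr{S}_\lambda/\mathscr{S}^\infty_\lambda\ltimes\mathbb{Z}(+)$ (in which $\mathscr{S}_\lambda/\mathscr{S}^\infty_\lambda$ is the normal factor).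
   Context: The infinite cardinal $\lambda$ is identified with a set of cardinality $\lambda$. $\mathscr{I}^{\mathrm{cf}}_\lambda$ is the set of all injective partial maps $\alpha\colon\lambda\rightharpoonup\lambda$ such that $\lambda\setminus\operatorname{dom}\alpha$ and $\lambda\setminus\operatorname{ran}\alpha$ are both finite. Maps are written on the right and composed left to right: $x(\alpha\beta)=(x\alpha)\beta$ for $x\in\operatorname{dom}(\alpha\beta)=\{y\in\operatorname{dom}\alpha\mid y\alpha\in\operatorname{dom}\beta\}$. With this operation $\mathscr{I}^{\mathrm{cf}}_\lambda$ is an inverse monoid with identity $\mathbb{I}$ (the identity map of $\lambda$); $H(\mathbb{I})$ denotes its group of units. The least group congruence $\sigma$ on an inverse semigroup $S$ is given by: $s\sigma t$ iff there exists an idempotent $e\in S$ such that $se=te$; the quotient $S/\sigma$ is a group. $\mathscr{S}_\lambda$ is the group of all bijections of $\lambda$ (it is identified with $H(\mathbb{I})$). For $\alpha\in\mathscr{S}_\lambda$, $\operatorname{supp}(\alpha)=\{x\in\lambda\mid (x)\alpha\neq x\}$, and $\mathscr{S}^\infty_\lambda=\{\alpha\in\mathscr{S}_\lambda\mid\operatorname{supp}(\alpha)\text{ is finite}\}$, a normal subgroup of $\mathscr{S}_\lambda$. The notation $(H(\mathbb{I}))\pi_\sigma=\mathscr{S}_\lambda/\mathscr{S}^\infty_\lambda$ means that the subgroup $(H(\mathbb{I}))\pi_\sigma$ of $\mathscr{I}^{\mathrm{cf}}_\lambda/\sigma$ is identified with the quotient group $\mathscr{S}_\lambda/\mathscr{S}^\infty_\lambda$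 via the isomorphism induced by the restriction of $\pi_\sigma$ to $H(\mathbb{I})=\mathscr{S}_\lambda$; in (ii) and (iii), $\mathscr{S}_\lambda/\mathscr{S}^\infty_\lambda$ stands for this subgroup. The semidirect product is taken with respect to some action of $\mathbb{Z}(+)$ on $\mathscr{S}_\lambda/\mathscr{S}^\infty_\lambda$ by automorphisms. *)

theory Defs
  imports "HOL-Algebra.Algebra"
begin

section \<open>The monoid of injective partial cofinite selfmaps\<close>

text \<open>
  The infinite cardinal is represented by an arbitrary infinite set \<open>L\<close>.  Maps act on the right,
  so the product of \<open>\<alpha>\<close> and \<open>\<beta>\<close> is \<open>\<beta> \<circ>\<^sub>m \<alpha>\<close>, i.e. first \<open>\<alpha>\<close>, then \<open>\<beta>\<close>.
\<close>

definition icf_maps :: "'a set \<Rightarrow> ('a \<rightharpoonup> 'a) set" where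
  "icf_maps L = {\<alpha>. dom \<alpha> \<subseteq> L \<and> ran \<alpha> \<subseteq> L \<and> inj_on \<alpha> (dom \<alpha>) \<and>
                    finite (L - dom \<alpha>) \<and> finite (L - ran \<alpha>)}"

definition icf_monoid :: "'a set \<Rightarrow> ('a \<rightharpoonup> 'a) monoid" where
  "icf_monoid L = \<lparr>carrier = icf_maps L,
                   monoid.mult = (\<lambda>\<alpha> \<beta>. \<beta> \<circ>\<^sub>m \<alpha>),
                   one = (\<lambda>x. if x \<in> L then Some x else None)\<rparr>"


section \<open>Congruences, quotients and the least group congruence\<close>

definition congruence_on :: "('a, 'b) monoid_scheme \<Rightarrow> ('a \<times> 'a) set \<Rightarrow> bool" where
  "congruence_on S r \<longleftrightarrow> equiv (carrier S) r \<and>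
     (\<forall>a b c d. (a, b) \<in> r \<longrightarrow> (c, d) \<in> r \<longrightarrow> (a \<otimes>\<^bsub>S\<^esub> c, b \<otimes>\<^bsub>S\<^esub> d) \<in> r)"

text \<open>For a congruence, the union in the product below is the single class of \<open>a \<otimes> b\<close>.\<close>

definition quot_monoid :: "('a, 'b) monoid_scheme \<Rightarrow> ('a \<times> 'a) set \<Rightarrow> 'a set monoid" where
  "quot_monoid S r = \<lparr>carrier = carrier S // r,
                      monoid.mult = (\<lambda>A B. \<Union>a\<in>A. \<Union>b\<in>B. r `` {a \<otimes>\<^bsub>S\<^esub> b}),
                      one = r `` {\<one>\<^bsub>S\<^esub>}\<rparr>"

definition nat_hom :: "('a \<times> 'a) set \<Rightarrow> 'a \<Rightarrow> 'a set" where
  "nat_hom r s = r `` {s}"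

definition group_congruence :: "('a, 'b) monoid_scheme \<Rightarrow> ('a \<times> 'a) set \<Rightarrow> bool" where
  "group_congruence S r \<longleftrightarrow> congruence_on S r \<and> group (quot_monoid S r)"

text \<open>
  The standard description of the least group congruence on an inverse semigroup; that it is
  indeed the least group congruence on \<open>icf_monoid L\<close> is the theorem
  \<open>sigma_least_group_congruence\<close> below.
\<close>

definition sigma :: "('a, 'b) monoid_scheme \<Rightarrow> ('a \<times> 'a) set" where
  "sigma S = {(s, t). s \<in> carrier S \<and> t \<in> carrier S \<and>
     (\<exists>e\<in>carrier S. e \<otimes>\<^bsub>S\<^esub> e = e \<and> s \<otimes>\<^bsub>S\<^esub> e = t \<otimes>\<^bsub>S\<^esub> e)}"


section \<open>Bijections and finitary bijections\<close>

text \<open>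
  The library group \<^const>\<open>BijGroup\<close> composes right to left; here the product is taken left
  to right, in accordance with \<^const>\<open>icf_monoid\<close>.
\<close>

definition sym_group_on :: "'a set \<Rightarrow> ('a \<Rightarrow> 'a) monoid" where
  "sym_group_on L = \<lparr>carrier = Bij L,
                     monoid.mult = (\<lambda>f g. compose L g f),
                     one = (\<lambda>x\<in>L. x)\<rparr>"

definition supp_on :: "'a set \<Rightarrow> ('a \<Rightarrow> 'a) \<Rightarrow> 'a set" where
  "supp_on L f = {x \<in> L. f x \<noteq> x}"

definition fin_sym :: "'a set \<Rightarrow> ('a \<Rightarrow> 'a) set" where
  "fin_sym L = {f \<in> Bij L. finite (supp_on L f)}"

text \<open>
  The identification of the bijections of \<open>L\<close> with the units of \<open>icf_monoid L\<close>; see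
  \<open>bij_to_icf_iso\<close> below.
\<close>

definition bij_to_icf :: "'a set \<Rightarrow> ('a \<Rightarrow> 'a) \<Rightarrow> ('a \<rightharpoonup> 'a)" where
  "bij_to_icf L f = (\<lambda>x. if x \<in> L then Some (f x) else None)"


section \<open>Semidirect products\<close>

text \<open>
  The first factor \<open>K\<close> is the normal one; \<open>\<theta>\<close> is meant to be a homomorphism from \<open>H\<close> to
  \<^term>\<open>AutoGroup K\<close>, i.e. a left action of \<open>H\<close> on \<open>K\<close> by automorphisms.
\<close>

definition semidirect_product ::
  "('a, 'c) monoid_scheme \<Rightarrow> ('b, 'd) monoid_scheme \<Rightarrow> ('b \<Rightarrow> 'a \<Rightarrow> 'a) \<Rightarrow> ('a \<times> 'b) monoid" where
  "semidirect_product K H \<theta> =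
     \<lparr>carrier = carrier K \<times> carrier H,
      monoid.mult = (\<lambda>(k, h) (k', h'). (k \<otimes>\<^bsub>K\<^esub> \<theta> h k', h \<otimes>\<^bsub>H\<^esub> h')),
      one = (\<one>\<^bsub>K\<^esub>, \<one>\<^bsub>H\<^esub>)\<rparr>"


section \<open>Basic facts\<close>

lemma icf_inj: "\<alpha> \<in> icf_maps L \<Longrightarrow> \<alpha> x = Some y \<Longrightarrow> \<alpha> x' = Some y \<Longrightarrow> x = x'"
  unfolding icf_maps_def inj_on_def by (auto simp: dom_def)

lemma icf_preimage_finite:
  assumes "\<alpha> \<in> icf_maps L" "finite F"
  shows "finite {x. \<exists>y\<in>F. \<alpha> x = Some y}"
proof (rule finite_subset)
  show "{x. \<exists>y\<in>F. \<alpha> x = Some y} \<subseteq> (\<lambda>y. THE x. \<alpha> x = Some y) ` F"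
  proof
    fix x assume "x \<in> {x. \<exists>y\<in>F. \<alpha> x = Some y}"
    then obtain y where y: "y \<in> F" "\<alpha> x = Some y" by blast
    then have "(THE x. \<alpha> x = Some y) = x"
      using icf_inj[OF assms(1)] by blast
    then show "x \<in> (\<lambda>y. THE x. \<alpha> x = Some y) ` F" using y by force
  qed
  show "finite ((\<lambda>y. THE x. \<alpha> x = Some y) ` F)" using assms by simp
qed

lemma icf_image_finite:
  assumes "finite F"
  shows "finite {y. \<exists>x\<in>F. \<alpha> x = Some y}"
proof (rule finite_subset)
  show "{y. \<exists>x\<in>F. \<alpha> x = Some y} \<subseteq> (\<lambda>x. the (\<alpha> x)) ` F" by force
qed (use assms in simp)

lemma icf_comp_closed:
  assumes a: "\<alpha> \<in> icf_maps L" and b: "\<beta> \<in> icf_maps L"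
  shows "\<beta> \<circ>\<^sub>m \<alpha> \<in> icf_maps L"
proof -
  have "finite (L - dom (\<beta> \<circ>\<^sub>m \<alpha>))"
  proof (rule finite_subset)
    show "L - dom (\<beta> \<circ>\<^sub>m \<alpha>) \<subseteq> (L - dom \<alpha>) \<union> {x. \<exists>y\<in>L - dom \<beta>. \<alpha> x = Some y}"
      using a by (auto simp: icf_maps_def map_comp_def dom_def ran_def split: option.splits)
    show "finite ((L - dom \<alpha>) \<union> {x. \<exists>y\<in>L - dom \<beta>. \<alpha> x = Some y})"
      using icf_preimage_finite[OF a, of "L - dom \<beta>"] a b by (auto simp: icf_maps_def)
  qed
  moreover have "finite (L - ran (\<beta> \<circ>\<^sub>m \<alpha>))"
  proof (rule finite_subset)
    show "L - ran (\<beta> \<circ>\<^sub>m \<alpha>) \<subseteq> (L - ran \<beta>) \<union> {y. \<exists>x\<in>L - ran \<alpha>. \<beta> x = Some y}"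
    proof
      fix z assume z: "z \<in> L - ran (\<beta> \<circ>\<^sub>m \<alpha>)"
      show "z \<in> (L - ran \<beta>) \<union> {y. \<exists>x\<in>L - ran \<alpha>. \<beta> x = Some y}"
      proof (cases "z \<in> ran \<beta>")
        case True
        then obtain y where y: "\<beta> y = Some z" by (auto simp: ran_def)
        then have "y \<in> L" using b by (auto simp: icf_maps_def)
        moreover have "y \<notin> ran \<alpha>"
        proof
          assume "y \<in> ran \<alpha>"
          then obtain x where "\<alpha> x = Some y" by (auto simp: ran_def)
          then have "(\<beta> \<circ>\<^sub>m \<alpha>) x = Some z" using y by simp
          then show False using z by (auto simp: ran_def)
        qed
        ultimately show ?thesis using y by blast
      qed (use z in blast)
    qed
    show "finite ((L - ran \<beta>) \<union> {y. \<exists>x\<in>L - ran \<alpha>. \<beta> x = Some y})"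
      using icf_image_finite[of "L - ran \<alpha>" \<beta>] a b by (auto simp: icf_maps_def)
  qed
  moreover have "inj_on (\<beta> \<circ>\<^sub>m \<alpha>) (dom (\<beta> \<circ>\<^sub>m \<alpha>))"
  proof (rule inj_onI)
    fix x x' assume "x \<in> dom (\<beta> \<circ>\<^sub>m \<alpha>)" and eq: "(\<beta> \<circ>\<^sub>m \<alpha>) x = (\<beta> \<circ>\<^sub>m \<alpha>) x'"
    then obtain z where z: "(\<beta> \<circ>\<^sub>m \<alpha>) x = Some z" by blast
    then obtain y y' where "\<alpha> x = Some y" "\<beta> y = Some z" "\<alpha> x' = Some y'" "\<beta> y' = Some z"
      using eq by (auto simp: map_comp_Some_iff)
    then show "x = x'" using icf_inj[OF a] icf_inj[OF b] by blast
  qed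
  moreover have "dom (\<beta> \<circ>\<^sub>m \<alpha>) \<subseteq> L" "ran (\<beta> \<circ>\<^sub>m \<alpha>) \<subseteq> L"
    using a b by (auto simp: icf_maps_def ran_def dom_def map_comp_Some_iff)
  ultimately show ?thesis by (simp add: icf_maps_def)
qed

lemma partial_id_icf:
  assumes "E \<subseteq> L" "finite (L - E)"
  shows "(\<lambda>x. if x \<in> E then Some x else None) \<in> icf_maps L"
proof -
  have "dom (\<lambda>x. if x \<in> E then Some x else None) = E"
    "ran (\<lambda>x. if x \<in> E then Some x else None) = E"
    by (auto simp: dom_def ran_def)
  then show ?thesis using assms by (auto simp: icf_maps_def inj_on_def)
qed

lemma monoid_icf: "monoid (icf_monoid L)"
proof (rule monoidI)
  show "\<one>\<^bsub>icf_monoid L\<^esub> \<in> carrier (icf_monoid L)"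
    using partial_id_icf[of L L] by (simp add: icf_monoid_def)
next
  fix x assume "x \<in> carrier (icf_monoid L)"
  then have "dom x \<subseteq> L" "ran x \<subseteq> L" by (auto simp: icf_monoid_def icf_maps_def)
  then show "\<one>\<^bsub>icf_monoid L\<^esub> \<otimes>\<^bsub>icf_monoid L\<^esub> x = x" "x \<otimes>\<^bsub>icf_monoid L\<^esub> \<one>\<^bsub>icf_monoid L\<^esub> = x"
    by (auto simp: icf_monoid_def map_comp_def fun_eq_iff dom_def ran_def subset_iff
        split: option.splits) (metis not_None_eq)+
next
  fix x y z :: "'a \<rightharpoonup> 'a"
  show "x \<otimes>\<^bsub>icf_monoid L\<^esub> y \<otimes>\<^bsub>icf_monoid L\<^esub> z = x \<otimes>\<^bsub>icf_monoid L\<^esub> (y \<otimes>\<^bsub>icf_monoid L\<^esub> z)"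
    by (auto simp: icf_monoid_def map_comp_def fun_eq_iff split: option.splits)
qed (auto simp: icf_monoid_def icf_comp_closed)

lemma sigma_icf_iff:
  "(s, t) \<in> sigma (icf_monoid L) \<longleftrightarrow>
     s \<in> icf_maps L \<and> t \<in> icf_maps L \<and> finite {x. s x \<noteq> t x}"
proof (intro iffI conjI)
  assume st: "(s, t) \<in> sigma (icf_monoid L)"
  then show s: "s \<in> icf_maps L" and t: "t \<in> icf_maps L"
    by (auto simp: sigma_def icf_monoid_def)
  from st obtain e where e: "e \<in> icf_maps L" "e \<circ>\<^sub>m e = e" "e \<circ>\<^sub>m s = e \<circ>\<^sub>m t"
    by (auto simp: sigma_def icf_monoid_def)
  have fin: "finite {x. \<exists>y\<in>L - dom e. s x = Some y}" "finite {x. \<exists>y\<in>L - dom e. t x = Some y}"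
    using e icf_preimage_finite[OF s, of "L - dom e"] icf_preimage_finite[OF t, of "L - dom e"]
    unfolding icf_maps_def by blast+
  have "{x. s x \<noteq> t x} \<subseteq> {x. \<exists>y\<in>L - dom e. s x = Some y} \<union> {x. \<exists>y\<in>L - dom e. t x = Some y}"
  proof
    fix x assume x: "x \<in> {x. s x \<noteq> t x}"
    show "x \<in> {x. \<exists>y\<in>L - dom e. s x = Some y} \<union> {x. \<exists>y\<in>L - dom e. t x = Some y}"
    proof (rule ccontr)
      assume n: "\<not> ?thesis"
      have L: "s x = Some y \<Longrightarrow> y \<in> L" "t x = Some y \<Longrightarrow> y \<in> L" for y
        using s t by (auto simp: icf_maps_def ran_def)
      have c: "(e \<circ>\<^sub>m s) x = (e \<circ>\<^sub>m t) x" using e by simp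
      have "s x = t x"
      proof (cases "s x")
        case None
        show ?thesis
        proof (cases "t x")
          case (Some b)
          with n L obtain z where "e b = Some z" by blast
          with c None Some show ?thesis by simp
        qed (use None in simp)
      next
        case sa: (Some a)
        with n L obtain z where z: "e a = Some z" by blast
        show ?thesis
        proof (cases "t x")
          case None with sa z c show ?thesis by simp
        next
          case (Some b)
          with sa z c have "e b = Some z" by simp
          with z have "a = b" using icf_inj[OF e(1)] by blast
          with sa Some show ?thesis by simp
        qed
      qed
      with x show False by simp
    qed
  qed
  then show "finite {x. s x \<noteq> t x}" by (rule finite_subset) (use fin in simp)
next
  assume a: "s \<in> icf_maps L \<and> t \<in> icf_maps L \<and> finite {x. s x \<noteq> t x}"
  define D where "D = {x. s x \<noteq> t x}"
  define E where "E = L - ({y. \<exists>x\<in>D. s x = Some y} \<union> {y. \<exists>x\<in>D. t x = Some y})"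
  define e where "e = (\<lambda>x. if x \<in> E then Some x else None)"
  have "finite ({y. \<exists>x\<in>D. s x = Some y} \<union> {y. \<exists>x\<in>D. t x = Some y})"
    using a icf_image_finite[of D s] icf_image_finite[of D t] by (simp add: D_def)
  then have "finite (L - E)"
    by (rule rev_finite_subset) (auto simp: E_def)
  then have "e \<in> icf_maps L" unfolding e_def by (intro partial_id_icf) (auto simp: E_def)
  moreover have "e \<circ>\<^sub>m e = e"
    by (auto simp: e_def map_comp_def fun_eq_iff)
  moreover have "e \<circ>\<^sub>m s = e \<circ>\<^sub>m t"
  proof
    fix x
    show "(e \<circ>\<^sub>m s) x = (e \<circ>\<^sub>m t) x"
    proof (cases "x \<in> D")
      case True
      then have "(e \<circ>\<^sub>m s) x = None" "(e \<circ>\<^sub>m t) x = None"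
        by (auto simp: map_comp_def e_def E_def split: option.splits)
      then show ?thesis by simp
    next
      case False
      then show ?thesis by (simp add: D_def map_comp_def)
    qed
  qed
  ultimately show "(s, t) \<in> sigma (icf_monoid L)"
    using a by (auto simp: sigma_def icf_monoid_def)
qed

lemma congruence_sigma_icf: "congruence_on (icf_monoid L) (sigma (icf_monoid L))"
  unfolding congruence_on_def
proof (intro conjI allI impI)
  show "equiv (carrier (icf_monoid L)) (sigma (icf_monoid L))"
  proof (rule equivI)
    show "sigma (icf_monoid L) \<subseteq> carrier (icf_monoid L) \<times> carrier (icf_monoid L)"
      by (auto simp: sigma_def)
    show "refl_on (carrier (icf_monoid L)) (sigma (icf_monoid L))"
      by (auto simp: refl_on_def sigma_icf_iff) (auto simp: icf_monoid_def)
    show "sym (sigma (icf_monoid L))"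
      by (auto simp: sym_def sigma_def)
    show "trans (sigma (icf_monoid L))"
    proof (rule transI)
      fix a b c
      assume ab: "(a, b) \<in> sigma (icf_monoid L)" and bc: "(b, c) \<in> sigma (icf_monoid L)"
      have "{x. a x \<noteq> c x} \<subseteq> {x. a x \<noteq> b x} \<union> {x. b x \<noteq> c x}" by auto
      then have "finite {x. a x \<noteq> c x}"
        by (rule finite_subset) (use ab bc in \<open>simp add: sigma_icf_iff\<close>)
      then show "(a, c) \<in> sigma (icf_monoid L)" using ab bc by (simp add: sigma_icf_iff)
    qed
  qed
next
  fix a b c d
  assume ab: "(a, b) \<in> sigma (icf_monoid L)" and cd: "(c, d) \<in> sigma (icf_monoid L)"
  have "{x. (c \<circ>\<^sub>m a) x \<noteq> (d \<circ>\<^sub>m b) x} \<subseteq>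
        {x. a x \<noteq> b x} \<union> {x. \<exists>y\<in>{y. c y \<noteq> d y}. a x = Some y}"
  proof
    fix x assume x: "x \<in> {x. (c \<circ>\<^sub>m a) x \<noteq> (d \<circ>\<^sub>m b) x}"
    show "x \<in> {x. a x \<noteq> b x} \<union> {x. \<exists>y\<in>{y. c y \<noteq> d y}. a x = Some y}"
    proof (cases "a x = b x")
      case True
      with x show ?thesis by (cases "b x") auto
    qed simp
  qed
  then have "finite {x. (c \<circ>\<^sub>m a) x \<noteq> (d \<circ>\<^sub>m b) x}"
    by (rule finite_subset)
      (use ab cd icf_preimage_finite[of a L "{y. c y \<noteq> d y}"] in \<open>simp add: sigma_icf_iff\<close>)
  then show "(a \<otimes>\<^bsub>icf_monoid L\<^esub> c, b \<otimes>\<^bsub>icf_monoid L\<^esub> d) \<in> sigma (icf_monoid L)"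
    using ab cd by (simp add: sigma_icf_iff icf_comp_closed) (simp add: icf_monoid_def icf_comp_closed)
qed

lemma quot_mult:
  assumes r: "congruence_on S r" and a: "a \<in> carrier S" and b: "b \<in> carrier S"
  shows "(r `` {a}) \<otimes>\<^bsub>quot_monoid S r\<^esub> (r `` {b}) = r `` {a \<otimes>\<^bsub>S\<^esub> b}"
proof -
  have eq: "equiv (carrier S) r" using r by (simp add: congruence_on_def)
  have "r `` {a' \<otimes>\<^bsub>S\<^esub> b'} = r `` {a \<otimes>\<^bsub>S\<^esub> b}" if "(a, a') \<in> r" "(b, b') \<in> r" for a' b'
  proof -
    have "(a \<otimes>\<^bsub>S\<^esub> b, a' \<otimes>\<^bsub>S\<^esub> b') \<in> r" using that r by (auto simp: congruence_on_def)
    then show ?thesis using equiv_class_eq[OF eq] by blast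
  qed
  moreover have "(a, a) \<in> r" "(b, b) \<in> r"
    using eq a b by (auto simp: equiv_def refl_on_def)
  ultimately have "(\<Union>a'\<in>r `` {a}. \<Union>b'\<in>r `` {b}. r `` {a' \<otimes>\<^bsub>S\<^esub> b'}) = r `` {a \<otimes>\<^bsub>S\<^esub> b}"
    by (intro equalityI UN_least) (blast, blast)
  then show ?thesis by (simp add: quot_monoid_def)
qed

lemma icf_left_inverse:
  assumes a: "\<alpha> \<in> icf_maps L"
  obtains \<beta> where "\<beta> \<in> icf_maps L" "(\<alpha> \<circ>\<^sub>m \<beta>, \<one>\<^bsub>icf_monoid L\<^esub>) \<in> sigma (icf_monoid L)"
    "\<And>x y. \<beta> y = Some x \<longleftrightarrow> \<alpha> x = Some y"
proof -
  define \<beta> where "\<beta> = (\<lambda>y. if y \<in> ran \<alpha> then Some (THE x. \<alpha> x = Some y) else None)"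
  have b: "\<beta> y = Some x \<longleftrightarrow> \<alpha> x = Some y" for x y
  proof
    assume h: "\<beta> y = Some x"
    then have "y \<in> ran \<alpha>" by (auto simp: \<beta>_def split: if_splits)
    then obtain x' where x': "\<alpha> x' = Some y" by (auto simp: ran_def)
    then have "(THE x. \<alpha> x = Some y) = x'" using icf_inj[OF a] by blast
    then show "\<alpha> x = Some y" using h x' \<open>y \<in> ran \<alpha>\<close> by (simp add: \<beta>_def)
  next
    assume h: "\<alpha> x = Some y"
    then have "(THE x. \<alpha> x = Some y) = x" using icf_inj[OF a] by blast
    then show "\<beta> y = Some x" using h by (auto simp: \<beta>_def ran_def)
  qed
  have "dom \<beta> = ran \<alpha>" "ran \<beta> = dom \<alpha>"
    by (auto simp: dom_def ran_def b)
  moreover have "inj_on \<beta> (dom \<beta>)"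
  proof (rule inj_onI)
    fix y y' assume "y \<in> dom \<beta>" "\<beta> y = \<beta> y'"
    then obtain x where "\<beta> y = Some x" "\<beta> y' = Some x" by (metis domD)
    then show "y = y'" by (simp add: b)
  qed
  ultimately have bi: "\<beta> \<in> icf_maps L" using a by (auto simp: icf_maps_def)
  have "{x. (\<alpha> \<circ>\<^sub>m \<beta>) x \<noteq> \<one>\<^bsub>icf_monoid L\<^esub> x} \<subseteq> L - ran \<alpha>"
  proof
    fix y assume y: "y \<in> {x. (\<alpha> \<circ>\<^sub>m \<beta>) x \<noteq> \<one>\<^bsub>icf_monoid L\<^esub> x}"
    have "y \<notin> ran \<alpha>"
    proof
      assume "y \<in> ran \<alpha>"
      then obtain x where x: "\<alpha> x = Some y" by (auto simp: ran_def)
      then have "\<beta> y = Some x" by (simp add: b)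
      moreover have "y \<in> L" using a x by (auto simp: icf_maps_def ran_def)
      ultimately show False using y x by (simp add: icf_monoid_def)
    qed
    moreover have "y \<in> L"
    proof (rule ccontr)
      assume "y \<notin> L"
      moreover have "\<beta> y = None" using bi \<open>y \<notin> L\<close> by (auto simp: icf_maps_def)
      ultimately show False using y by (simp add: icf_monoid_def map_comp_def)
    qed
    ultimately show "y \<in> L - ran \<alpha>" by blast
  qed
  moreover have "finite (L - ran \<alpha>)" using a by (simp add: icf_maps_def)
  ultimately have "finite {x. (\<alpha> \<circ>\<^sub>m \<beta>) x \<noteq> \<one>\<^bsub>icf_monoid L\<^esub> x}" by (rule finite_subset)
  moreover have "\<one>\<^bsub>icf_monoid L\<^esub> \<in> icf_maps L"
    using partial_id_icf[of L L] by (simp add: icf_monoid_def)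
  ultimately have "(\<alpha> \<circ>\<^sub>m \<beta>, \<one>\<^bsub>icf_monoid L\<^esub>) \<in> sigma (icf_monoid L)"
    using icf_comp_closed[OF bi a] by (simp add: sigma_icf_iff)
  then show ?thesis using that bi b by blast
qed

lemma group_quot_sigma_icf: "group (quot_monoid (icf_monoid L) (sigma (icf_monoid L)))"
proof -
  let ?M = "icf_monoid L" and ?r = "sigma (icf_monoid L)"
  interpret M: monoid ?M by (rule monoid_icf)
  note cong = congruence_sigma_icf[of L]
  have eq: "equiv (carrier ?M) ?r" using cong by (simp add: congruence_on_def)
  have car: "carrier (quot_monoid ?M ?r) = (\<lambda>a. ?r `` {a}) ` carrier ?M"
    by (auto simp: quot_monoid_def quotient_def)
  have one: "\<one>\<^bsub>quot_monoid ?M ?r\<^esub> = ?r `` {\<one>\<^bsub>?M\<^esub>}" by (simp add: quot_monoid_def)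
  show ?thesis
  proof (rule groupI)
    fix x assume "x \<in> carrier (quot_monoid ?M ?r)"
    then obtain a where a: "a \<in> carrier ?M" "x = ?r `` {a}" by (auto simp: car)
    then have "a \<in> icf_maps L" by (simp add: icf_monoid_def)
    then obtain b where b: "b \<in> icf_maps L" "(a \<circ>\<^sub>m b, \<one>\<^bsub>?M\<^esub>) \<in> ?r"
      by (rule icf_left_inverse)
    then have "b \<in> carrier ?M" by (simp add: icf_monoid_def)
    moreover have "(b \<otimes>\<^bsub>?M\<^esub> a, \<one>\<^bsub>?M\<^esub>) \<in> ?r" using b by (simp add: icf_monoid_def)
    then have "?r `` {b \<otimes>\<^bsub>?M\<^esub> a} = ?r `` {\<one>\<^bsub>?M\<^esub>}" by (rule equiv_class_eq[OF eq])
    ultimately show "\<exists>y\<in>carrier (quot_monoid ?M ?r).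
        y \<otimes>\<^bsub>quot_monoid ?M ?r\<^esub> x = \<one>\<^bsub>quot_monoid ?M ?r\<^esub>"
      using a by (auto simp: car one quot_mult[OF cong])
  qed (auto simp: car one quot_mult[OF cong] M.m_assoc)
qed

theorem sigma_least_group_congruence:
  "group_congruence (icf_monoid L) (sigma (icf_monoid L))"
  "group_congruence (icf_monoid L) r \<Longrightarrow> sigma (icf_monoid L) \<subseteq> r"
proof -
  show "group_congruence (icf_monoid L) (sigma (icf_monoid L))"
    by (simp add: group_congruence_def congruence_sigma_icf group_quot_sigma_icf)
  assume "group_congruence (icf_monoid L) r"
  then have cong: "congruence_on (icf_monoid L) r" and g: "group (quot_monoid (icf_monoid L) r)"
    by (auto simp: group_congruence_def)
  have eq: "equiv (carrier (icf_monoid L)) r" using cong by (simp add: congruence_on_def)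
  have car: "r `` {a} \<in> carrier (quot_monoid (icf_monoid L) r)" if "a \<in> carrier (icf_monoid L)" for a
    using that by (auto simp: quot_monoid_def quotient_def)
  show "sigma (icf_monoid L) \<subseteq> r"
  proof (rule subrelI)
    fix s t assume "(s, t) \<in> sigma (icf_monoid L)"
    then obtain e where e: "s \<in> carrier (icf_monoid L)" "t \<in> carrier (icf_monoid L)"
      "e \<in> carrier (icf_monoid L)" "s \<otimes>\<^bsub>icf_monoid L\<^esub> e = t \<otimes>\<^bsub>icf_monoid L\<^esub> e"
      by (auto simp: sigma_def)
    then have "(r `` {s}) \<otimes>\<^bsub>quot_monoid (icf_monoid L) r\<^esub> (r `` {e}) =
               (r `` {t}) \<otimes>\<^bsub>quot_monoid (icf_monoid L) r\<^esub> (r `` {e})"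
      by (simp add: quot_mult[OF cong])
    then have "r `` {s} = r `` {t}"
      using group.right_cancel[OF g] car e by metis
    then show "(s, t) \<in> r" using eq_equiv_class[OF _ eq] e by metis
  qed
qed

lemma nat_hom_hom:
  "congruence_on S r \<Longrightarrow> nat_hom r \<in> hom S (quot_monoid S r)"
  by (rule homI) (auto simp: nat_hom_def quot_mult, auto simp: quot_monoid_def quotient_def)

lemma group_sym_group_on: "group (sym_group_on L)"
proof (rule groupI)
  fix x assume "x \<in> carrier (sym_group_on L)"
  then have x: "x \<in> Bij L" by (simp add: sym_group_on_def)
  then have "compose L x (restrict (inv_into L x) L) = (\<lambda>x\<in>L. x)"
    by (auto simp: Bij_def compose_def fun_eq_iff bij_betw_inv_into_right)
  then show "\<exists>y\<in>carrier (sym_group_on L). y \<otimes>\<^bsub>sym_group_on L\<^esub> x = \<one>\<^bsub>sym_group_on L\<^esub>"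
    using restrict_inv_into_Bij[OF x] by (auto simp: sym_group_on_def)
next
  fix x assume "x \<in> carrier (sym_group_on L)"
  then show "\<one>\<^bsub>sym_group_on L\<^esub> \<otimes>\<^bsub>sym_group_on L\<^esub> x = x"
    by (auto simp: sym_group_on_def Bij_def compose_def extensional_def fun_eq_iff)
qed (auto simp: sym_group_on_def compose_Bij id_Bij Bij_imp_funcset compose_assoc)

lemma supp_on_compose: "supp_on L (compose L f g) \<subseteq> supp_on L f \<union> supp_on L g"
  by (auto simp: supp_on_def compose_def)

lemma fin_sym_normal: "fin_sym L \<lhd> sym_group_on L"
proof -
  interpret G: group "sym_group_on L" by (rule group_sym_group_on)
  have inv: "f x = y \<longleftrightarrow> (inv\<^bsub>sym_group_on L\<^esub> f) y = x" if "f \<in> Bij L" "x \<in> L" "y \<in> L" for f x y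
  proof -
    have f: "f \<in> carrier (sym_group_on L)" using that by (simp add: sym_group_on_def)
    have "compose L (inv\<^bsub>sym_group_on L\<^esub> f) f = (\<lambda>x\<in>L. x)"
         "compose L f (inv\<^bsub>sym_group_on L\<^esub> f) = (\<lambda>x\<in>L. x)"
      using G.r_inv[OF f] G.l_inv[OF f] by (auto simp: sym_group_on_def)
    then show ?thesis using that by (auto simp: compose_def fun_eq_iff) metis+
  qed
  have invB: "inv\<^bsub>sym_group_on L\<^esub> f \<in> Bij L" if "f \<in> Bij L" for f
    using G.inv_closed[of f] that by (simp add: sym_group_on_def)
  have sub: "subgroup (fin_sym L) (sym_group_on L)"
  proof (rule subgroup.intro)
    show "fin_sym L \<subseteq> carrier (sym_group_on L)" by (auto simp: fin_sym_def sym_group_on_def)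
    show "\<one>\<^bsub>sym_group_on L\<^esub> \<in> fin_sym L"
      by (auto simp: fin_sym_def sym_group_on_def id_Bij supp_on_def)
  next
    fix x y assume "x \<in> fin_sym L" "y \<in> fin_sym L"
    then show "x \<otimes>\<^bsub>sym_group_on L\<^esub> y \<in> fin_sym L"
      using finite_subset[OF supp_on_compose[of L y x]]
      by (auto simp: fin_sym_def sym_group_on_def compose_Bij)
  next
    fix x assume x: "x \<in> fin_sym L"
    then have "supp_on L (inv\<^bsub>sym_group_on L\<^esub> x) = supp_on L x"
      using inv[of x] unfolding supp_on_def fin_sym_def by blast
    then show "inv\<^bsub>sym_group_on L\<^esub> x \<in> fin_sym L"
      using x invB by (simp add: fin_sym_def)
  qed
  show ?thesis
    unfolding G.normal_inv_iff
  proof (intro conjI ballI sub)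
    fix x h assume "x \<in> carrier (sym_group_on L)" and h: "h \<in> fin_sym L"
    then have x: "x \<in> Bij L" by (simp add: sym_group_on_def)
    let ?g = "x \<otimes>\<^bsub>sym_group_on L\<^esub> h \<otimes>\<^bsub>sym_group_on L\<^esub> inv\<^bsub>sym_group_on L\<^esub> x"
    have g: "?g = compose L (inv\<^bsub>sym_group_on L\<^esub> x) (compose L h x)"
      by (simp add: sym_group_on_def)
    have xL: "y \<in> L \<Longrightarrow> x y \<in> L" "y \<in> L \<Longrightarrow> h y \<in> L" for y
      using x h by (auto simp: fin_sym_def Bij_def bij_betw_def)
    have "x ` supp_on L ?g \<subseteq> supp_on L h"
    proof
      fix z assume "z \<in> x ` supp_on L ?g"
      then obtain y where y: "y \<in> L" "z = x y" "?g y \<noteq> y" by (auto simp: supp_on_def)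
      then have "(inv\<^bsub>sym_group_on L\<^esub> x) (h (x y)) \<noteq> y" by (simp add: g compose_eq)
      then have "h (x y) \<noteq> x y" using inv[OF x y(1), of "x y"] y xL by auto
      then show "z \<in> supp_on L h" using y xL by (simp add: supp_on_def)
    qed
    then have "finite (x ` supp_on L ?g)"
      by (rule finite_subset) (use h in \<open>simp add: fin_sym_def\<close>)
    moreover have "inj_on x (supp_on L ?g)"
      using x by (auto simp: Bij_def bij_betw_def supp_on_def inj_on_def)
    ultimately have "finite (supp_on L ?g)" by (rule finite_imageD)
    then show "?g \<in> fin_sym L"
      using x h invB by (simp add: fin_sym_def g compose_Bij)
  qed
qed

lemma bij_to_icf_carrier: "f \<in> Bij L \<Longrightarrow> bij_to_icf L f \<in> icf_maps L"
proof -
  assume f: "f \<in> Bij L"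
  then have "dom (bij_to_icf L f) = L" "ran (bij_to_icf L f) = L"
    by (force simp: bij_to_icf_def dom_def ran_def Bij_def bij_betw_def split: if_splits)+
  then show ?thesis
    using f by (auto simp: icf_maps_def inj_on_def bij_to_icf_def Bij_def bij_betw_def)
qed

lemma bij_to_icf_mult:
  "f \<in> Bij L \<Longrightarrow> bij_to_icf L (compose L g f) = bij_to_icf L g \<circ>\<^sub>m bij_to_icf L f"
  using Bij_imp_funcset[of f L]
  by (auto simp: bij_to_icf_def compose_def fun_eq_iff map_comp_def)

theorem bij_to_icf_iso: "bij_to_icf L \<in> iso (sym_group_on L) (units_of (icf_monoid L))"
proof -
  interpret G: group "sym_group_on L" by (rule group_sym_group_on)
  have one: "bij_to_icf L (\<one>\<^bsub>sym_group_on L\<^esub>) = \<one>\<^bsub>icf_monoid L\<^esub>"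
    by (auto simp: bij_to_icf_def sym_group_on_def icf_monoid_def)
  have mult: "bij_to_icf L (f \<otimes>\<^bsub>sym_group_on L\<^esub> g) =
      bij_to_icf L f \<otimes>\<^bsub>icf_monoid L\<^esub> bij_to_icf L g" if "f \<in> carrier (sym_group_on L)" for f g
    using that bij_to_icf_mult by (auto simp: sym_group_on_def icf_monoid_def)
  have car: "bij_to_icf L f \<in> carrier (icf_monoid L)" if "f \<in> carrier (sym_group_on L)" for f
    using that bij_to_icf_carrier by (auto simp: sym_group_on_def icf_monoid_def)
  have units: "bij_to_icf L f \<in> Units (icf_monoid L)" if f: "f \<in> carrier (sym_group_on L)" for f
    unfolding Units_def
    using car[OF f] car[OF G.inv_closed[OF f]] mult[OF f, of "inv\<^bsub>sym_group_on L\<^esub> f"]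
      mult[OF G.inv_closed[OF f], of f] one f by auto
  have inj: "inj_on (bij_to_icf L) (carrier (sym_group_on L))"
  proof (rule inj_onI)
    fix f g assume f: "f \<in> carrier (sym_group_on L)" and g: "g \<in> carrier (sym_group_on L)"
      and e: "bij_to_icf L f = bij_to_icf L g"
    have "f x = g x" if "x \<in> L" for x
      using fun_cong[OF e, of x] that by (simp add: bij_to_icf_def)
    then show "f = g"
      using f g by (intro extensionalityI[of f L g]) (auto simp: sym_group_on_def Bij_def)
  qed
  have surj: "u \<in> bij_to_icf L ` carrier (sym_group_on L)" if u: "u \<in> Units (icf_monoid L)" for u
  proof -
    from u obtain v where uv: "u \<in> icf_maps L" "v \<in> icf_maps L"
      "v \<circ>\<^sub>m u = \<one>\<^bsub>icf_monoid L\<^esub>" "u \<circ>\<^sub>m v = \<one>\<^bsub>icf_monoid L\<^esub>"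
      by (auto simp: Units_def icf_monoid_def)
    have u1: "\<exists>y\<in>L. u x = Some y" if "x \<in> L" for x
    proof -
      have "(v \<circ>\<^sub>m u) x = Some x" using uv that by (simp add: icf_monoid_def)
      then obtain y where "u x = Some y" by (auto simp: map_comp_Some_iff)
      then show ?thesis using uv by (auto simp: icf_maps_def ran_def)
    qed
    have u2: "\<exists>x\<in>L. u x = Some y" if "y \<in> L" for y
    proof -
      have "(u \<circ>\<^sub>m v) y = Some y" using uv that by (simp add: icf_monoid_def)
      then obtain x where "u x = Some y" by (auto simp: map_comp_Some_iff)
      then show ?thesis using uv by (auto simp: icf_maps_def dom_def)
    qed
    define f where "f = (\<lambda>x\<in>L. the (u x))"
    have ux: "u x = Some (f x)" if "x \<in> L" for x using u1[OF that] that by (auto simp: f_def)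
    have "inj_on f L" using icf_inj[OF uv(1)] ux by (metis inj_onI)
    moreover have "f ` L = L" using u1 u2 ux by force
    ultimately have "f \<in> Bij L" by (auto simp: Bij_def bij_betw_def f_def)
    moreover have "u = bij_to_icf L f"
    proof
      fix x
      show "u x = bij_to_icf L f x"
        using ux uv by (auto simp: bij_to_icf_def icf_maps_def)
    qed
    ultimately show ?thesis by (auto simp: sym_group_on_def)
  qed
  show ?thesis
    using units mult inj surj
    by (auto simp: iso_def hom_def bij_betw_def units_of_def)
qed

end

theory Submission
  imports Defs
begin

text \<open>
  Two cofinite partial injections are identified by the least group congruence exactly when they
  differ at finitely many points only.  What survives this identification is an integer, the index
  \<open>|L - dom \<alpha>| - |L - ran \<alpha>|\<close>, an analogue of the Fredholm index.  Restricting \<open>\<alpha>\<close> to a cofinite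
  part \<open>E\<close> of its domain removes equally many points from the domain and from the range, so the
  index may be computed from any such \<open>E\<close> and its image (\<open>index_restrict\<close>).  This one observation
  gives both that equivalent maps have the same index (compare them on the set where they agree) and
  that the index is additive (follow the domain of a product through both factors).  The index is
  therefore a homomorphism from the quotient group \<open>Q\<close> to the integers.

  Its kernel is the image \<open>N\<close> of the group of units.  Bijections of \<open>L\<close> have index \<open>0\<close>; conversely
  a map of index \<open>0\<close> misses as many points in its domain as in its range, so it extends to a
  bijection of \<open>L\<close> that differs from it at finitely many points (\<open>index_zero_imp_sigma_bij\<close>).
  Hence \<open>N\<close> is normal.  Bijections that become trivial in \<open>Q\<close> are those with finite support, so the
  first isomorphism theorem identifies \<open>N\<close> with the bijections modulo the finitary ones.

  Since \<open>L\<close> is infinite, there is a bijection from \<open>L\<close> minus a point onto \<open>L\<close>, which has index \<open>1\<close>.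
  The powers of its class form a section of the index homomorphism.  So \<open>Q\<close> is a split extension of
  the integers by \<open>N\<close>, and the remaining claims hold in any split extension: the image of the section
  is a complement of the kernel, and the extension is the semidirect product for the action by
  conjugation.
\<close>

section \<open>Split extensions\<close>

text \<open>
  The first term is an abstract group \<open>K\<close> embedded by \<open>\<phi>\<close>, not a subgroup of \<open>Q\<close>, so that the
  semidirect product has the factor group of the symmetric group itself as its normal factor.
\<close>

locale split_extension =
  K: group K + H: group H + Q: group Q
  for K :: "('k, 'm) monoid_scheme" and H :: "('h, 'n) monoid_scheme"
    and Q :: "('q, 'l) monoid_scheme" +
  fixes \<phi> :: "'k \<Rightarrow> 'q" and d :: "'q \<Rightarrow> 'h" and s :: "'h \<Rightarrow> 'q"
  assumes \<phi>_hom: "\<phi> \<in> hom K Q" and d_hom: "d \<in> hom Q H" and s_hom: "s \<in> hom H Q"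
    and \<phi>_inj: "inj_on \<phi> (carrier K)"
    and exact: "\<phi> ` carrier K = kernel Q H d"
    and d_s: "h \<in> carrier H \<Longrightarrow> d (s h) = h"
begin

sublocale \<phi>: group_hom K Q \<phi> by unfold_locales (rule \<phi>_hom)
sublocale d: group_hom Q H d by unfold_locales (rule d_hom)
sublocale s: group_hom H Q s by unfold_locales (rule s_hom)

lemma inv_mult_cancel [simp]:
  "x \<in> carrier Q \<Longrightarrow> y \<in> carrier Q \<Longrightarrow> inv\<^bsub>Q\<^esub> x \<otimes>\<^bsub>Q\<^esub> (x \<otimes>\<^bsub>Q\<^esub> y) = y"
  by (simp flip: Q.m_assoc)

lemma d_\<phi> [simp]: "k \<in> carrier K \<Longrightarrow> d (\<phi> k) = \<one>\<^bsub>H\<^esub>"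
  using exact by (auto simp: kernel_def)

text \<open>
  Restricted to the carrier because elements of \<^const>\<open>AutoGroup\<close> are extensional functions.
\<close>

definition conj_action :: "'h \<Rightarrow> 'k \<Rightarrow> 'k" where
  "conj_action h = (\<lambda>k\<in>carrier K. inv_into (carrier K) \<phi> (s h \<otimes>\<^bsub>Q\<^esub> \<phi> k \<otimes>\<^bsub>Q\<^esub> inv\<^bsub>Q\<^esub> s h))"

lemma pullback:
  assumes "q \<in> carrier Q" "d q = \<one>\<^bsub>H\<^esub>"
  shows "inv_into (carrier K) \<phi> q \<in> carrier K" "\<phi> (inv_into (carrier K) \<phi> q) = q"
proof -
  have "q \<in> \<phi> ` carrier K" using assms exact by (simp add: kernel_def)
  then show "inv_into (carrier K) \<phi> q \<in> carrier K" "\<phi> (inv_into (carrier K) \<phi> q) = q"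
    by (simp_all add: inv_into_into f_inv_into_f)
qed

lemma conj_action:
  assumes "h \<in> carrier H" "k \<in> carrier K"
  shows "conj_action h k \<in> carrier K"
    and "\<phi> (conj_action h k) = s h \<otimes>\<^bsub>Q\<^esub> \<phi> k \<otimes>\<^bsub>Q\<^esub> inv\<^bsub>Q\<^esub> s h"
proof -
  have "d (s h \<otimes>\<^bsub>Q\<^esub> \<phi> k \<otimes>\<^bsub>Q\<^esub> inv\<^bsub>Q\<^esub> s h) = \<one>\<^bsub>H\<^esub>"
    using assms by (simp add: d_s)
  then show "conj_action h k \<in> carrier K"
      "\<phi> (conj_action h k) = s h \<otimes>\<^bsub>Q\<^esub> \<phi> k \<otimes>\<^bsub>Q\<^esub> inv\<^bsub>Q\<^esub> s h"
    using assms pullback[of "s h \<otimes>\<^bsub>Q\<^esub> \<phi> k \<otimes>\<^bsub>Q\<^esub> inv\<^bsub>Q\<^esub> s h"] by (simp_all add: conj_action_def)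
qed

text \<open>
  Identities in \<open>K\<close> are checked after applying \<open>\<phi>\<close>, where the action is honest conjugation in \<open>Q\<close>.
\<close>

lemma eq_if_\<phi>_eq: "\<phi> k = \<phi> k' \<Longrightarrow> k \<in> carrier K \<Longrightarrow> k' \<in> carrier K \<Longrightarrow> k = k'"
  using \<phi>_inj by (rule inj_onD)

lemma conj_action_mult:
  assumes "h \<in> carrier H" "h' \<in> carrier H" "k \<in> carrier K"
  shows "conj_action (h \<otimes>\<^bsub>H\<^esub> h') k = conj_action h (conj_action h' k)"
  using assms
  by (intro eq_if_\<phi>_eq) (simp_all add: conj_action Q.m_assoc Q.inv_mult_group)

lemma conj_action_one: "k \<in> carrier K \<Longrightarrow> conj_action \<one>\<^bsub>H\<^esub> k = k"
  by (intro eq_if_\<phi>_eq) (simp_all add: conj_action)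

lemma conj_action_auto:
  assumes h: "h \<in> carrier H"
  shows "conj_action h \<in> auto K"
  unfolding auto_def
proof (rule IntI)
  show "conj_action h \<in> hom K K"
  proof (rule homI)
    fix x y assume "x \<in> carrier K" "y \<in> carrier K"
    then show "conj_action h (x \<otimes>\<^bsub>K\<^esub> y) = conj_action h x \<otimes>\<^bsub>K\<^esub> conj_action h y"
      using h by (intro eq_if_\<phi>_eq) (simp_all add: conj_action Q.m_assoc)
  qed (simp add: h conj_action)
  have "bij_betw (conj_action h) (carrier K) (carrier K)"
    by (rule bij_betw_byWitness[where f' = "conj_action (inv\<^bsub>H\<^esub> h)"])
      (use h in \<open>auto simp: conj_action conj_action_one simp flip: conj_action_mult\<close>)
  then show "conj_action h \<in> Bij (carrier K)"
    by (simp add: Bij_def conj_action_def)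
qed

lemma conj_action_hom: "conj_action \<in> hom H (AutoGroup K)"
proof (rule homI)
  fix h assume "h \<in> carrier H"
  then show "conj_action h \<in> carrier (AutoGroup K)"
    by (simp add: AutoGroup_def conj_action_auto)
next
  fix h h' assume h: "h \<in> carrier H" "h' \<in> carrier H"
  have "conj_action (h \<otimes>\<^bsub>H\<^esub> h') = compose (carrier K) (conj_action h) (conj_action h')"
  proof
    fix k
    show "conj_action (h \<otimes>\<^bsub>H\<^esub> h') k = compose (carrier K) (conj_action h) (conj_action h') k"
      using conj_action_mult[OF h]
      by (cases "k \<in> carrier K") (simp_all add: compose_def conj_action_def)
  qed
  moreover have "conj_action h \<in> Bij (carrier K)" "conj_action h' \<in> Bij (carrier K)"
    using conj_action_auto h by (simp_all add: auto_def)
  ultimately show "conj_action (h \<otimes>\<^bsub>H\<^esub> h') =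
      conj_action h \<otimes>\<^bsub>AutoGroup K\<^esub> conj_action h'"
    by (simp add: AutoGroup_def BijGroup_def)
qed

text \<open>
  Cancelling the image of \<open>q\<close> in \<open>H\<close> by the section leaves an element of the kernel.  This is the
  first coordinate of \<open>q\<close> in the semidirect product.
\<close>

lemma kernel_part:
  assumes "q \<in> carrier Q"
  shows "inv_into (carrier K) \<phi> (q \<otimes>\<^bsub>Q\<^esub> inv\<^bsub>Q\<^esub> s (d q)) \<in> carrier K"
    and "\<phi> (inv_into (carrier K) \<phi> (q \<otimes>\<^bsub>Q\<^esub> inv\<^bsub>Q\<^esub> s (d q))) = q \<otimes>\<^bsub>Q\<^esub> inv\<^bsub>Q\<^esub> s (d q)"
  using pullback[of "q \<otimes>\<^bsub>Q\<^esub> inv\<^bsub>Q\<^esub> s (d q)"] assms by (simp_all add: d_s)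

theorem iso_semidirect_product: "Q \<cong> semidirect_product K H conj_action"
proof -
  define r where "r q = inv_into (carrier K) \<phi> (q \<otimes>\<^bsub>Q\<^esub> inv\<^bsub>Q\<^esub> s (d q))" for q
  have r: "r q \<in> carrier K" "\<phi> (r q) = q \<otimes>\<^bsub>Q\<^esub> inv\<^bsub>Q\<^esub> s (d q)" if "q \<in> carrier Q" for q
    using kernel_part[OF that] by (simp_all add: r_def)
  have "(\<lambda>q. (r q, d q)) \<in> iso Q (semidirect_product K H conj_action)"
  proof (rule isoI)
    show "(\<lambda>q. (r q, d q)) \<in> hom Q (semidirect_product K H conj_action)"
    proof (rule homI)
      fix x y assume xy: "x \<in> carrier Q" "y \<in> carrier Q"
      have "r (x \<otimes>\<^bsub>Q\<^esub> y) = r x \<otimes>\<^bsub>K\<^esub> conj_action (d x) (r y)"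
        using xy by (intro eq_if_\<phi>_eq)
          (simp_all add: r conj_action Q.m_assoc Q.inv_mult_group)
      then show "(r (x \<otimes>\<^bsub>Q\<^esub> y), d (x \<otimes>\<^bsub>Q\<^esub> y)) =
          (r x, d x) \<otimes>\<^bsub>semidirect_product K H conj_action\<^esub> (r y, d y)"
        using xy by (simp add: semidirect_product_def)
    qed (simp add: semidirect_product_def r)
    \<comment> \<open>Uniqueness and existence of the factorization \<open>q = \<phi> k \<otimes> s h\<close>.\<close>
    show "bij_betw (\<lambda>q. (r q, d q)) (carrier Q) (carrier (semidirect_product K H conj_action))"
    proof (rule bij_betw_byWitness[where f' = "\<lambda>(k, h). \<phi> k \<otimes>\<^bsub>Q\<^esub> s h"])
      show "\<forall>q\<in>carrier Q. (\<lambda>(k, h). \<phi> k \<otimes>\<^bsub>Q\<^esub> s h) (r q, d q) = q"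
        by (simp add: r Q.m_assoc)
      have "r (\<phi> k \<otimes>\<^bsub>Q\<^esub> s h) = k" if "k \<in> carrier K" "h \<in> carrier H" for k h
        using that by (intro eq_if_\<phi>_eq) (simp_all add: r Q.m_assoc d_s)
      then show "\<forall>p\<in>carrier (semidirect_product K H conj_action).
          (\<lambda>q. (r q, d q)) ((\<lambda>(k, h). \<phi> k \<otimes>\<^bsub>Q\<^esub> s h) p) = p"
        by (auto simp: semidirect_product_def d_s)
    qed (auto simp: semidirect_product_def r)
  qed
  then show ?thesis by (auto simp: is_iso_def)
qed

lemma section_inter_kernel: "s ` carrier H \<inter> kernel Q H d = {\<one>\<^bsub>Q\<^esub>}"
proof -
  have "s h = \<one>\<^bsub>Q\<^esub>" if "h \<in> carrier H" "d (s h) = \<one>\<^bsub>H\<^esub>" for h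
    using that d_s[of h] by simp
  moreover have "\<one>\<^bsub>Q\<^esub> \<in> s ` carrier H"
    using s.hom_one H.one_closed by (metis imageI)
  moreover have "\<one>\<^bsub>Q\<^esub> \<in> kernel Q H d" by (simp add: kernel_def)
  ultimately show ?thesis unfolding kernel_def by blast
qed

lemma kernel_mult_section: "kernel Q H d <#>\<^bsub>Q\<^esub> s ` carrier H = carrier Q"
proof
  show "kernel Q H d <#>\<^bsub>Q\<^esub> s ` carrier H \<subseteq> carrier Q"
    by (auto simp: set_mult_def kernel_def)
  show "carrier Q \<subseteq> kernel Q H d <#>\<^bsub>Q\<^esub> s ` carrier H"
  proof
    fix q assume q: "q \<in> carrier Q"
    then have "q = (q \<otimes>\<^bsub>Q\<^esub> inv\<^bsub>Q\<^esub> s (d q)) \<otimes>\<^bsub>Q\<^esub> s (d q)"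
      by (simp add: Q.m_assoc)
    moreover have "q \<otimes>\<^bsub>Q\<^esub> inv\<^bsub>Q\<^esub> s (d q) \<in> kernel Q H d"
      using q by (simp add: kernel_def d_s)
    ultimately show "q \<in> kernel Q H d <#>\<^bsub>Q\<^esub> s ` carrier H"
      using q by (force simp: set_mult_def)
  qed
qed

lemma section_subgroup: "subgroup (s ` carrier H) Q"
  by (rule s.img_is_subgroup)

lemma section_iso: "Q\<lparr>carrier := s ` carrier H\<rparr> \<cong> H"
proof -
  have "inj_on s (carrier H)" using d_s by (metis inj_onI)
  then have "s \<in> iso H (Q\<lparr>carrier := s ` carrier H\<rparr>)"
    by (auto simp: iso_iff hom_def)
  then show ?thesis using H.iso_sym by (auto simp: is_iso_def)
qed

end


section \<open>Homomorphisms out of quotients\<close>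

lemma quot_monoid_induced_hom:
  assumes r: "congruence_on S r" and S: "monoid S" and f: "f \<in> hom S T"
    and inv: "\<And>a b. (a, b) \<in> r \<Longrightarrow> f a = f b"
  shows "(\<lambda>A. the_elem (f ` A)) \<in> hom (quot_monoid S r) T"
    and "a \<in> carrier S \<Longrightarrow> the_elem (f ` nat_hom r a) = f a"
proof -
  interpret S: monoid S by (rule S)
  have val: "the_elem (f ` nat_hom r a) = f a" if "a \<in> carrier S" for a
  proof (rule the_elem_image_unique)
    have "(a, a) \<in> r" using r that by (auto simp: congruence_on_def equiv_def refl_on_def)
    then show "nat_hom r a \<noteq> {}" by (auto simp: nat_hom_def)
  qed (auto simp: nat_hom_def dest: inv)
  then show "a \<in> carrier S \<Longrightarrow> the_elem (f ` nat_hom r a) = f a" .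
  have car: "carrier (quot_monoid S r) = nat_hom r ` carrier S"
    by (auto simp: quot_monoid_def quotient_def nat_hom_def)
  show "(\<lambda>A. the_elem (f ` A)) \<in> hom (quot_monoid S r) T"
  proof (rule homI)
    fix A assume "A \<in> carrier (quot_monoid S r)"
    then show "the_elem (f ` A) \<in> carrier T"
      using f by (auto simp: car val hom_def)
  next
    fix A B assume "A \<in> carrier (quot_monoid S r)" "B \<in> carrier (quot_monoid S r)"
    then obtain a b where ab: "a \<in> carrier S" "A = nat_hom r a" "b \<in> carrier S" "B = nat_hom r b"
      by (auto simp: car)
    then have "A \<otimes>\<^bsub>quot_monoid S r\<^esub> B = nat_hom r (a \<otimes>\<^bsub>S\<^esub> b)"
      using quot_mult[OF r] by (simp add: nat_hom_def)
    then show "the_elem (f ` (A \<otimes>\<^bsub>quot_monoid S r\<^esub> B)) =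
        the_elem (f ` A) \<otimes>\<^bsub>T\<^esub> the_elem (f ` B)"
      using ab f by (simp add: val hom_mult)
  qed
qed


section \<open>The index of a cofinite partial injection\<close>

definition index :: "'a set \<Rightarrow> ('a \<rightharpoonup> 'a) \<Rightarrow> int" where
  "index L \<alpha> = int (card (L - dom \<alpha>)) - int (card (L - ran \<alpha>))"

text \<open>
  Passing from \<open>dom \<alpha>\<close> to \<open>E\<close> enlarges both complements by the same number of points, because \<open>\<alpha>\<close>
  is injective on \<open>dom \<alpha> - E\<close>.
\<close>

lemma index_restrict:
  assumes a: "\<alpha> \<in> icf_maps L" and E: "E \<subseteq> dom \<alpha>" "finite (L - E)"
  shows "finite (L - (the \<circ> \<alpha>) ` E)"
    and "index L \<alpha> = int (card (L - E)) - int (card (L - (the \<circ> \<alpha>) ` E))"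
proof -
  let ?f = "the \<circ> \<alpha>"
  have L: "dom \<alpha> \<subseteq> L" "ran \<alpha> \<subseteq> L" "finite (L - dom \<alpha>)" "finite (L - ran \<alpha>)"
    using a by (auto simp: icf_maps_def)
  have ran: "ran \<alpha> = ?f ` dom \<alpha>" by (force simp: ran_def dom_def)
  have inj: "inj_on ?f (dom \<alpha>)"
    using icf_inj[OF a] by (auto simp: inj_on_def)
  let ?D = "dom \<alpha> - E"
  have fD: "finite ?D" using E L by (meson Diff_mono finite_subset order_refl)
  have im: "?f ` ?D = ran \<alpha> - ?f ` E"
    using inj_on_image_set_diff[OF inj Diff_subset E(1)] by (simp only: ran)
  have "card (?f ` ?D) = card ?D"
    using inj by (meson Diff_subset card_image inj_on_subset)
  moreover have LE: "L - E = (L - dom \<alpha>) \<union> ?D" using E L by auto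
  have "card (L - E) = card (L - dom \<alpha>) + card ?D"
    unfolding LE using L fD by (intro card_Un_disjoint) auto
  moreover have LfE: "L - ?f ` E = (L - ran \<alpha>) \<union> ?f ` ?D"
    unfolding im using E L ran by blast
  have "card (L - ?f ` E) = card (L - ran \<alpha>) + card (?f ` ?D)"
    unfolding LfE
    by (intro card_Un_disjoint L(4) finite_imageI fD) (use im in blast)
  ultimately show "index L \<alpha> = int (card (L - E)) - int (card (L - ?f ` E))"
    by (simp add: index_def)
  show "finite (L - ?f ` E)" unfolding LfE using L(4) finite_imageI[OF fD] by (rule finite_UnI)
qed

text \<open>Both indices are computed from the common restriction to the set where the maps agree.\<close>

lemma index_sigma_invariant:
  assumes "(\<alpha>, \<beta>) \<in> sigma (icf_monoid L)"
  shows "index L \<alpha> = index L \<beta>"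
proof -
  have ab: "\<alpha> \<in> icf_maps L" "\<beta> \<in> icf_maps L" and fin: "finite {x. \<alpha> x \<noteq> \<beta> x}"
    using assms by (simp_all add: sigma_icf_iff)
  define E where "E = dom \<alpha> \<inter> dom \<beta> \<inter> {x. \<alpha> x = \<beta> x}"
  have "L - E \<subseteq> (L - dom \<alpha>) \<union> (L - dom \<beta>) \<union> {x. \<alpha> x \<noteq> \<beta> x}" by (auto simp: E_def)
  then have f: "finite (L - E)"
    by (rule finite_subset) (use fin ab in \<open>simp add: icf_maps_def\<close>)
  have "E \<subseteq> dom \<alpha>" "E \<subseteq> dom \<beta>" by (auto simp: E_def)
  moreover have "(the \<circ> \<alpha>) ` E = (the \<circ> \<beta>) ` E" by (rule image_cong) (auto simp: E_def)
  ultimately show ?thesis using index_restrict(2) ab f by metis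
qed

text \<open>
  With \<open>E\<close> the domain of the product, \<open>F\<close> its image under \<open>\<alpha>\<close> and \<open>R\<close> the image of \<open>F\<close> under \<open>\<beta>\<close>,
  the three indices are \<open>|L - E| - |L - R|\<close>, \<open>|L - E| - |L - F|\<close> and \<open>|L - F| - |L - R|\<close>, and the
  sum telescopes.
\<close>

lemma index_mult:
  assumes a: "\<alpha> \<in> icf_maps L" and b: "\<beta> \<in> icf_maps L"
  shows "index L (\<beta> \<circ>\<^sub>m \<alpha>) = index L \<alpha> + index L \<beta>"
proof -
  let ?E = "dom (\<beta> \<circ>\<^sub>m \<alpha>)" and ?F = "(the \<circ> \<alpha>) ` dom (\<beta> \<circ>\<^sub>m \<alpha>)"
  have c: "\<beta> \<circ>\<^sub>m \<alpha> \<in> icf_maps L" using a b by (rule icf_comp_closed)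
  then have fE: "finite (L - ?E)" by (simp add: icf_maps_def)
  have E: "?E \<subseteq> dom \<alpha>" by (auto simp: map_comp_Some_iff)
  have F: "?F \<subseteq> dom \<beta>" by (auto simp: map_comp_Some_iff)
  have "(the \<circ> \<beta>) ` ?F = (the \<circ> (\<beta> \<circ>\<^sub>m \<alpha>)) ` ?E"
    unfolding image_image by (rule image_cong) (auto simp: map_comp_Some_iff)
  then show ?thesis
    using index_restrict[OF a E fE] index_restrict[OF b F] index_restrict[OF c subset_refl fE]
    by simp
qed

lemma index_hom: "index L \<in> hom (icf_monoid L) integer_group"
  by (rule homI) (simp_all add: icf_monoid_def index_mult)

lemma partial_bij_icf:
  assumes "bij_betw h A B" "A \<subseteq> L" "B \<subseteq> L" "finite (L - A)" "finite (L - B)"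
  defines "\<alpha> \<equiv> (\<lambda>x. if x \<in> A then Some (h x) else None)"
  shows "\<alpha> \<in> icf_maps L" "index L \<alpha> = int (card (L - A)) - int (card (L - B))"
proof -
  have "dom \<alpha> = A" "ran \<alpha> = B"
    using assms(1) by (auto simp: \<alpha>_def dom_def ran_def bij_betw_def)
  moreover have "inj_on \<alpha> A"
    using assms(1) by (auto simp: \<alpha>_def bij_betw_def inj_on_def)
  ultimately show "\<alpha> \<in> icf_maps L" "index L \<alpha> = int (card (L - A)) - int (card (L - B))"
    using assms by (simp_all add: icf_maps_def index_def)
qed

text \<open>An infinite set is in bijection with itself minus one point.\<close>

lemma index_one_exists:
  assumes "infinite L"
  obtains \<alpha> where "\<alpha> \<in> icf_maps L" "index L \<alpha> = 1"
proof -
  obtain a where a: "a \<in> L" using assms by fastforce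
  obtain h where "bij_betw h L (L - {a})" using infinite_imp_bij_betw[OF assms] by blast
  then have h: "bij_betw (inv_into L h) (L - {a}) L" by (rule bij_betw_inv_into)
  have La: "L - (L - {a}) = {a}" using a by blast
  show ?thesis
    by (rule that) (use partial_bij_icf[OF h, of L] in \<open>simp_all add: La\<close>)
qed

lemma index_bij_to_icf:
  assumes "f \<in> Bij L"
  shows "index L (bij_to_icf L f) = 0"
  unfolding bij_to_icf_def
  using partial_bij_icf(2)[of f L L L] assms by (simp add: Bij_def)

text \<open>
  Index \<open>0\<close> says that the finite sets \<open>L - dom \<alpha>\<close> and \<open>L - ran \<alpha>\<close> have equal size; any bijection
  between them completes \<open>\<alpha>\<close> to a bijection of \<open>L\<close>, changing it at finitely many points.
\<close>

lemma index_zero_imp_sigma_bij: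
  assumes a: "\<alpha> \<in> icf_maps L" and "index L \<alpha> = 0"
  obtains f where "f \<in> Bij L" "(\<alpha>, bij_to_icf L f) \<in> sigma (icf_monoid L)"
proof -
  have L: "dom \<alpha> \<subseteq> L" "ran \<alpha> \<subseteq> L" "finite (L - dom \<alpha>)" "finite (L - ran \<alpha>)"
    using a by (auto simp: icf_maps_def)
  have "card (L - dom \<alpha>) = card (L - ran \<alpha>)" using assms(2) by (simp add: index_def)
  then obtain g where g: "bij_betw g (L - dom \<alpha>) (L - ran \<alpha>)"
    using finite_same_card_bij[OF L(3,4)] by blast
  have "(the \<circ> \<alpha>) ` dom \<alpha> = ran \<alpha>" by (force simp: ran_def dom_def)
  moreover have "inj_on (the \<circ> \<alpha>) (dom \<alpha>)" using icf_inj[OF a] by (auto simp: inj_on_def)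
  ultimately have "bij_betw (the \<circ> \<alpha>) (dom \<alpha>) (ran \<alpha>)" by (simp add: bij_betw_def)
  then have "bij_betw (\<lambda>x. if x \<in> dom \<alpha> then (the \<circ> \<alpha>) x else g x)
      (dom \<alpha> \<union> (L - dom \<alpha>)) (ran \<alpha> \<union> (L - ran \<alpha>))"
    using g by (rule bij_betw_disjoint_Un) auto
  moreover define f where "f = (\<lambda>x\<in>L. if x \<in> dom \<alpha> then (the \<circ> \<alpha>) x else g x)"
  moreover have "dom \<alpha> \<union> (L - dom \<alpha>) = L" "ran \<alpha> \<union> (L - ran \<alpha>) = L" using L by auto
  ultimately have f: "f \<in> Bij L" by (simp add: Bij_def)
  have "{x. \<alpha> x \<noteq> bij_to_icf L f x} \<subseteq> L - dom \<alpha>"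
    using L by (auto simp: bij_to_icf_def f_def split: if_splits)
  then have "finite {x. \<alpha> x \<noteq> bij_to_icf L f x}" using L finite_subset by blast
  then show ?thesis using that f a bij_to_icf_carrier[OF f] by (simp add: sigma_icf_iff)
qed

lemma sigma_bij_to_icf_one_iff:
  assumes "f \<in> Bij L"
  shows "(bij_to_icf L f, \<one>\<^bsub>icf_monoid L\<^esub>) \<in> sigma (icf_monoid L) \<longleftrightarrow> f \<in> fin_sym L"
proof -
  have "{x. bij_to_icf L f x \<noteq> \<one>\<^bsub>icf_monoid L\<^esub> x} = supp_on L f"
    by (auto simp: bij_to_icf_def icf_monoid_def supp_on_def)
  moreover have "\<one>\<^bsub>icf_monoid L\<^esub> \<in> icf_maps L"
    using partial_id_icf[of L L] by (simp add: icf_monoid_def)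
  ultimately show ?thesis
    using assms bij_to_icf_carrier by (auto simp: sigma_icf_iff fin_sym_def)
qed


section \<open>The structure of the quotient\<close>

lemma (in group_hom) FactGroup_the_elem_coset:
  assumes "g \<in> carrier G"
  shows "the_elem (h ` (kernel G H h #> g)) = h g"
proof -
  have "h ` (kernel G H h #> g) = {h g}"
    using assms by (auto simp: kernel_def r_coset_def image_def intro!: exI[of _ "\<one>"])
  then show ?thesis by simp
qed

theorem theorem3p6:
  fixes L :: "'a set"
  assumes "infinite L"
  defines "I \<equiv> icf_monoid L"
  defines "\<sigma> \<equiv> sigma I"
  defines "\<pi> \<equiv> nat_hom \<sigma>"
  defines "Q \<equiv> quot_monoid I \<sigma>"
  defines "N \<equiv> \<pi> ` Units I"
  defines "K \<equiv> sym_group_on L Mod fin_sym L"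
  shows
    "(N \<lhd> Q \<and>
      (\<exists>\<phi>\<in>iso K (Q\<lparr>carrier := N\<rparr>).
        \<forall>f\<in>carrier (sym_group_on L).
          \<phi> (fin_sym L #>\<^bsub>sym_group_on L\<^esub> f) = \<pi> (bij_to_icf L f))) \<and>
     (\<exists>G. subgroup G Q \<and> Q\<lparr>carrier := G\<rparr> \<cong> integer_group \<and>
        G \<inter> N = {\<one>\<^bsub>Q\<^esub>} \<and>
        N <#>\<^bsub>Q\<^esub> G = carrier Q) \<and>
     (\<exists>\<theta>\<in>hom integer_group (AutoGroup K).
        Q \<cong> semidirect_product K integer_group \<theta>)"
proof -
  let ?S = "sym_group_on L"
  interpret Q: group Q unfolding Q_def I_def \<sigma>_def by (rule group_quot_sigma_icf)
  interpret S: group ?S by (rule group_sym_group_on)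
  have cong: "congruence_on I \<sigma>" unfolding I_def \<sigma>_def by (rule congruence_sigma_icf)
  have eq: "equiv (carrier I) \<sigma>" using cong by (simp add: congruence_on_def)
  have carI: "carrier I = icf_maps L" by (simp add: I_def icf_monoid_def)
  have carS: "carrier ?S = Bij L" by (simp add: sym_group_on_def)
  have carQ: "carrier Q = \<pi> ` icf_maps L"
    by (auto simp: Q_def quot_monoid_def quotient_def nat_hom_def \<pi>_def carI)
  have oneQ: "\<one>\<^bsub>Q\<^esub> = \<pi> \<one>\<^bsub>I\<^esub>" by (simp add: Q_def quot_monoid_def \<pi>_def nat_hom_def)
  have oneI: "\<one>\<^bsub>I\<^esub> \<in> icf_maps L" using monoid.one_closed[OF monoid_icf[of L]] carI
    by (simp add: I_def)
  have \<pi>_eq: "\<pi> a = \<pi> b \<longleftrightarrow> (a, b) \<in> \<sigma>" if "a \<in> icf_maps L" "b \<in> icf_maps L" for a b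
    using that eq_equiv_class_iff[OF eq] by (simp add: \<pi>_def nat_hom_def carI)
  have \<pi>_hom: "\<pi> \<in> hom I Q" unfolding \<pi>_def Q_def by (rule nat_hom_hom[OF cong])

  \<comment> \<open>The index on classes; its kernel is \<open>N\<close>, which makes \<open>N\<close> normal.\<close>
  define D where "D A = the_elem (index L ` A)" for A
  have D_hom: "D \<in> hom Q integer_group" and D\<pi>: "a \<in> icf_maps L \<Longrightarrow> D (\<pi> a) = index L a" for a
    using quot_monoid_induced_hom[OF cong _ index_hom[of L, folded I_def] index_sigma_invariant]
      monoid_icf[of L, folded I_def]
    unfolding D_def[abs_def] Q_def \<pi>_def carI by (simp_all add: \<sigma>_def I_def)
  interpret Z: group integer_group by simp
  interpret D: group_hom Q integer_group D by unfold_locales (rule D_hom)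

  have units: "Units I = bij_to_icf L ` Bij L"
    using bij_to_icf_iso[of L] by (simp add: iso_iff units_of_def carS I_def)
  have N: "N = kernel Q integer_group D"
  proof
    show "N \<subseteq> kernel Q integer_group D"
      by (auto simp: N_def units kernel_def D\<pi> carQ bij_to_icf_carrier index_bij_to_icf)
    show "kernel Q integer_group D \<subseteq> N"
    proof
      fix q assume "q \<in> kernel Q integer_group D"
      then obtain a where a: "a \<in> icf_maps L" "q = \<pi> a" "index L a = 0"
        by (auto simp: kernel_def carQ D\<pi>)
      then obtain f where f: "f \<in> Bij L" "(a, bij_to_icf L f) \<in> \<sigma>"
        using index_zero_imp_sigma_bij unfolding \<sigma>_def I_def by metis
      then have "q = \<pi> (bij_to_icf L f)" using a \<pi>_eq[OF a(1) bij_to_icf_carrier[OF f(1)]] by simp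
      then show "q \<in> N" using f by (auto simp: N_def units)
    qed
  qed
  have N_normal: "N \<lhd> Q" unfolding N by (rule D.normal_kernel)

  \<comment> \<open>The first isomorphism theorem, applied to the bijections mapped onto \<open>N\<close>.\<close>
  define \<psi> where "\<psi> f = \<pi> (bij_to_icf L f)" for f
  have \<psi>N: "\<psi> ` carrier ?S = N" by (auto simp: \<psi>_def N_def units carS)
  have \<psi>_mult: "\<psi> (f \<otimes>\<^bsub>?S\<^esub> g) = \<psi> f \<otimes>\<^bsub>Q\<^esub> \<psi> g" if "f \<in> carrier ?S" "g \<in> carrier ?S" for f g
  proof -
    have "bij_to_icf L (f \<otimes>\<^bsub>?S\<^esub> g) = bij_to_icf L f \<otimes>\<^bsub>I\<^esub> bij_to_icf L g"
      using that by (simp add: I_def icf_monoid_def sym_group_on_def bij_to_icf_mult)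
    then show ?thesis
      using that \<pi>_hom by (simp add: \<psi>_def hom_mult carS carI bij_to_icf_carrier)
  qed
  interpret QN: group "Q\<lparr>carrier := N\<rparr>"
    by (rule Q.subgroup_imp_group[OF normal_imp_subgroup[OF N_normal]])
  interpret \<psi>: group_hom ?S "Q\<lparr>carrier := N\<rparr>" \<psi>
    by unfold_locales (use \<psi>N \<psi>_mult in \<open>auto simp: hom_def\<close>)
  have ker: "kernel ?S (Q\<lparr>carrier := N\<rparr>) \<psi> = fin_sym L"
  proof -
    have "\<psi> f = \<one>\<^bsub>Q\<^esub> \<longleftrightarrow> f \<in> fin_sym L" if "f \<in> Bij L" for f
      using sigma_bij_to_icf_one_iff[OF that] bij_to_icf_carrier[OF that] oneI
      by (simp add: \<psi>_def oneQ \<pi>_eq I_def \<sigma>_def)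
    then show ?thesis by (auto simp: kernel_def carS fin_sym_def)
  qed
  define \<phi> where "\<phi> C = the_elem (\<psi> ` C)" for C
  have \<phi>_iso: "\<phi> \<in> iso K (Q\<lparr>carrier := N\<rparr>)"
    using \<psi>.FactGroup_iso_set \<psi>N unfolding \<phi>_def[abs_def] K_def ker by simp
  have \<phi>_coset: "\<phi> (fin_sym L #>\<^bsub>?S\<^esub> f) = \<pi> (bij_to_icf L f)" if "f \<in> carrier ?S" for f
    using \<psi>.FactGroup_the_elem_coset[OF that] by (simp add: \<phi>_def ker \<psi>_def)

  \<comment> \<open>Powers of a class of index \<open>1\<close> split the index homomorphism.\<close>
  obtain \<alpha> where \<alpha>: "\<alpha> \<in> icf_maps L" "index L \<alpha> = 1"
    using index_one_exists[OF assms(1)] .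
  define s :: "int \<Rightarrow> _" where "s n = \<pi> \<alpha> [^]\<^bsub>Q\<^esub> n" for n
  have t: "\<pi> \<alpha> \<in> carrier Q" using \<alpha> carQ by blast
  interpret K: group K unfolding K_def by (rule normal.factorgroup_is_group[OF fin_sym_normal])
  interpret split_extension K integer_group Q \<phi> D s
  proof unfold_locales
    have "N \<subseteq> carrier Q" by (auto simp: N kernel_def)
    then show "\<phi> \<in> hom K Q" using \<phi>_iso by (auto simp: iso_def hom_def)
    show "D \<in> hom Q integer_group" by (rule D_hom)
    show "s \<in> hom integer_group Q"
      using Q.hom_integer_group_pow[OF t] by (simp add: s_def[abs_def])
    show "inj_on \<phi> (carrier K)" "\<phi> ` carrier K = kernel Q integer_group D"
      using \<phi>_iso by (simp_all add: iso_iff N)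
    show "D (s h) = h" for h
      using D.hom_int_pow[OF t] by (simp add: s_def D\<pi> \<alpha>)
  qed
  have "s ` carrier integer_group \<inter> N = {\<one>\<^bsub>Q\<^esub>}"
    "N <#>\<^bsub>Q\<^esub> s ` carrier integer_group = carrier Q"
    unfolding N by (rule section_inter_kernel, rule kernel_mult_section)
  moreover have "\<forall>f\<in>carrier ?S. \<phi> (fin_sym L #>\<^bsub>?S\<^esub> f) = \<pi> (bij_to_icf L f)"
    using \<phi>_coset by (rule ballI)
  ultimately show ?thesis
    by (intro conjI bexI exI)
      (rule N_normal \<phi>_iso section_subgroup section_iso conj_action_hom iso_semidirect_product
        | assumption)+
qed

end
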